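(* For every odd prime $p$, all integers $r,q\ge 1$, and every faithful character $\chi$ of $(1+p^r\mathbf Z_p)/(1+p^{q+r}\mathbf Z_p)$, the $p^q\times p^q$ matrix $H=H_{p;r,q}$ with entries $H(a,b)=\chi(1+p^r ab)$, $a,b\in R_q=\mathbf Z/p^q\mathbf Z$, has all entries equal to $p^q$-th roots of unity and satisfies $HH^*=p^q I$. That is, $H$ is a $BH(p^q,p^q)$ Butson matrix.
   Context: $\mathbf Z_p$ is the ring of $p$-adic integers and $R_q=\mathbf Z/p^q\mathbf Z$. For $p$ odd, the quotient $(1+p^r\mathbf Z_p)/(1+p^{q+r}\mathbf Z_p)$ of the multiplicative group of principal units is cyclic of order $p^q$; a faithful character is an injective homomorphism $\chi$ from it to the group of complex $p^q$-th roots of unity. The expression $\chi(1+p^r ab)$ for $a,b\in R_q$ is computed with any lifts of $a,b$ to $\mathbf Z_p$; the class of $1+p^r ab$ modulo $p^{q+r}$ does not depend on the lifts. A $BH(n,k)$ Butson matrix is an $n\times n$ complex matrix $H$ whose entries are $k$-th roots of unity and such that $HH^*=nI$, where $H^*$ is the conjugate transpose. *)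

theory Defs
  imports "HOL-Algebra.Coset" "HOL-Algebra.Ring" "HOL-Number_Theory.Cong"
    "Jordan_Normal_Form.Schur_Decomposition"
begin

text \<open>
  The ring of \<open>p\<close>-adic integers as the inverse limit of the rings \<open>\<int>/p\<^sup>n\<int>\<close>: the component \<open>x n\<close>
  is the representative in \<open>{0..<p^n}\<close> of the residue of \<open>x\<close> modulo \<open>p\<^sup>n\<close>.
\<close>

definition padic_ints :: "nat \<Rightarrow> (nat \<Rightarrow> int) ring" where
  "padic_ints p =
    \<lparr>carrier = {x. \<forall>n. x n \<in> {0..<int p ^ n} \<and> x (Suc n) mod int p ^ n = x n},
     monoid.mult = (\<lambda>x y n. (x n * y n) mod int p ^ n),
     one = (\<lambda>n. 1 mod int p ^ n),
     zero = (\<lambda>n. 0),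
     add = (\<lambda>x y n. (x n + y n) mod int p ^ n)\<rparr>"

text \<open>The set \<open>1 + p\<^sup>k\<int>\<^sub>p\<close>; for \<open>k \<ge> 1\<close> it is a group of units, see \<open>subgroup_principal_units\<close>.\<close>

definition principal_units :: "nat \<Rightarrow> nat \<Rightarrow> (nat \<Rightarrow> int) set" where
  "principal_units p k =
    {\<one>\<^bsub>padic_ints p\<^esub> \<oplus>\<^bsub>padic_ints p\<^esub> add_pow (padic_ints p) (p ^ k) z | z. z \<in> carrier (padic_ints p)}"

definition principal_unit_group :: "nat \<Rightarrow> nat \<Rightarrow> (nat \<Rightarrow> int) monoid" where
  "principal_unit_group p k = (units_of (padic_ints p))\<lparr>carrier := principal_units p k\<rparr>"

definition unit_quotient :: "nat \<Rightarrow> nat \<Rightarrow> nat \<Rightarrow> (nat \<Rightarrow> int) set monoid" where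
  "unit_quotient p r q = principal_unit_group p r Mod principal_units p (q + r)"

definition unit_class :: "nat \<Rightarrow> nat \<Rightarrow> nat \<Rightarrow> (nat \<Rightarrow> int) \<Rightarrow> (nat \<Rightarrow> int) set" where
  "unit_class p r q u = principal_units p (q + r) #>\<^bsub>principal_unit_group p r\<^esub> u"

definition roots_of_unity_group :: "nat \<Rightarrow> complex monoid" where
  "roots_of_unity_group n = \<lparr>carrier = {z. z ^ n = 1}, monoid.mult = (*), one = 1\<rparr>"

definition faithful_character ::
    "nat \<Rightarrow> nat \<Rightarrow> nat \<Rightarrow> ((nat \<Rightarrow> int) set \<Rightarrow> complex) \<Rightarrow> bool" where
  "faithful_character p r q \<chi> \<longleftrightarrow>
    \<chi> \<in> hom (unit_quotient p r q) (roots_of_unity_group (p ^ q)) \<and>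
    inj_on \<chi> (carrier (unit_quotient p r q))"

text \<open>
  Elements of \<open>\<int>/p\<^sup>q\<int>\<close> are given by their representatives \<open>a < p^q\<close>, which are lifted to the
  \<open>p\<close>-adic integers \<open>a\<cdot>1\<close>; by \<open>character_matrix_lift\<close> below every other choice of lifts gives
  the same matrix.
\<close>

definition character_matrix ::
    "nat \<Rightarrow> nat \<Rightarrow> nat \<Rightarrow> ((nat \<Rightarrow> int) set \<Rightarrow> complex) \<Rightarrow> complex mat" where
  "character_matrix p r q \<chi> = mat (p ^ q) (p ^ q) (\<lambda>(a, b).
    let Z = padic_ints p in
      \<chi> (unit_class p r q
        (\<one>\<^bsub>Z\<^esub> \<oplus>\<^bsub>Z\<^esub> add_pow Z (p ^ r) (add_pow Z a \<one>\<^bsub>Z\<^esub> \<otimes>\<^bsub>Z\<^esub> add_pow Z b \<one>\<^bsub>Z\<^esub>))))"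

definition butson :: "nat \<Rightarrow> nat \<Rightarrow> complex mat \<Rightarrow> bool" where
  "butson n k H \<longleftrightarrow>
    H \<in> carrier_mat n n \<and>
    (\<forall>i<n. \<forall>j<n. (H $$ (i, j)) ^ k = 1) \<and>
    H * mat_adjoint H = of_nat n \<cdot>\<^sub>m 1\<^sub>m n"


subsection \<open>The constructions are well defined\<close>

lemma padic_carrier_iff:
  "x \<in> carrier (padic_ints p) \<longleftrightarrow>
    (\<forall>n. 0 \<le> x n \<and> x n < int p ^ n \<and> x (Suc n) mod int p ^ n = x n)"
  by (auto simp: padic_ints_def)

lemma padic_ops:
  "(x \<otimes>\<^bsub>padic_ints p\<^esub> y) n = (x n * y n) mod int p ^ n"
  "(x \<oplus>\<^bsub>padic_ints p\<^esub> y) n = (x n + y n) mod int p ^ n"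
  "\<one>\<^bsub>padic_ints p\<^esub> n = 1 mod int p ^ n"
  "\<zero>\<^bsub>padic_ints p\<^esub> n = 0"
  by (simp_all add: padic_ints_def)

lemma padic_mod:
  assumes "x \<in> carrier (padic_ints p)"
  shows "x n mod int p ^ n = x n"
  using assms by (simp add: padic_carrier_iff)

lemma padic_mod_le:
  assumes "x \<in> carrier (padic_ints p)" "n \<le> m"
  shows "x m mod int p ^ n = x n"
  using assms(2)
proof (induction m rule: dec_induct)
  case base
  then show ?case using padic_mod[OF assms(1)] .
next
  case (step m)
  have "x (Suc m) mod int p ^ n = (x (Suc m) mod int p ^ m) mod int p ^ n"
    using step by (simp add: mod_mod_cancel le_imp_power_dvd)
  then show ?case using step assms(1) by (simp add: padic_carrier_iff)
qed

lemma padic_closedI: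
  assumes "p > 0" "\<And>n. f (Suc n) mod int p ^ n = f n mod int p ^ n"
  shows "(\<lambda>n. f n mod int p ^ n) \<in> carrier (padic_ints p)"
  using assms by (auto simp: padic_carrier_iff mod_mod_cancel le_imp_power_dvd)

lemma cring_padic_ints:
  assumes "p > 0"
  shows "cring (padic_ints p)"
proof (rule cringI)
  let ?Z = "padic_ints p"
  have Suc_mod: "x (Suc n) mod int p ^ n = x n" if "x \<in> carrier ?Z" for x n
    using that by (simp add: padic_carrier_iff)
  have add: "x \<oplus>\<^bsub>?Z\<^esub> y \<in> carrier ?Z" and mult: "x \<otimes>\<^bsub>?Z\<^esub> y \<in> carrier ?Z"
    if "x \<in> carrier ?Z" "y \<in> carrier ?Z" for x y
  proof -
    have "(\<lambda>n. (x n + y n) mod int p ^ n) \<in> carrier ?Z"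
      by (rule padic_closedI[OF assms])
        (metis Suc_mod that mod_add_eq)
    then show "x \<oplus>\<^bsub>?Z\<^esub> y \<in> carrier ?Z" by (simp add: padic_ints_def)
    have "(\<lambda>n. (x n * y n) mod int p ^ n) \<in> carrier ?Z"
      by (rule padic_closedI[OF assms])
        (metis Suc_mod that mod_mult_eq)
    then show "x \<otimes>\<^bsub>?Z\<^esub> y \<in> carrier ?Z" by (simp add: padic_ints_def)
  qed
  have one: "\<one>\<^bsub>?Z\<^esub> \<in> carrier ?Z"
    using padic_closedI[OF assms, of "\<lambda>n. 1"] by (simp add: padic_ints_def)
  have zero: "\<zero>\<^bsub>?Z\<^esub> \<in> carrier ?Z"
    using padic_closedI[OF assms, of "\<lambda>n. 0"] by (simp add: padic_ints_def)
  show "abelian_group ?Z"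
  proof (rule abelian_groupI)
    fix x assume x: "x \<in> carrier ?Z"
    have "(\<lambda>n. (- x n) mod int p ^ n) \<in> carrier ?Z"
      by (rule padic_closedI[OF assms]) (metis Suc_mod x mod_minus_eq)
    moreover have "(\<lambda>n. (- x n) mod int p ^ n) \<oplus>\<^bsub>?Z\<^esub> x = \<zero>\<^bsub>?Z\<^esub>"
      by (rule ext) (simp add: padic_ops mod_simps)
    ultimately show "\<exists>y\<in>carrier ?Z. y \<oplus>\<^bsub>?Z\<^esub> x = \<zero>\<^bsub>?Z\<^esub>" by blast
  qed (auto simp: add zero padic_ops padic_mod mod_simps add_ac fun_eq_iff)
  show "comm_monoid ?Z"
    by (rule comm_monoidI) (auto simp: mult one padic_ops padic_mod mod_simps mult_ac fun_eq_iff)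
qed (auto simp: padic_ops mod_simps distrib_right fun_eq_iff)

lemma padic_add_pow:
  assumes "p > 0"
  shows "add_pow (padic_ints p) (k :: nat) x n = (int k * x n) mod int p ^ n"
proof -
  interpret cring "padic_ints p" using assms by (rule cring_padic_ints)
  show ?thesis
    by (induction k) (simp_all add: add.nat_pow_0 add.nat_pow_Suc padic_ops mod_simps algebra_simps)
qed

lemma principal_units_iff:
  assumes "p > 0"
  shows "x \<in> principal_units p k \<longleftrightarrow> x \<in> carrier (padic_ints p) \<and> x k = 1 mod int p ^ k"
proof -
  let ?Z = "padic_ints p"
  interpret cring ?Z using assms by (rule cring_padic_ints)
  show ?thesis
  proof
    assume "x \<in> principal_units p k"
    then show "x \<in> carrier ?Z \<and> x k = 1 mod int p ^ k"
      by (auto simp: principal_units_def padic_ops padic_add_pow[OF assms] mod_simps)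
  next
    assume x: "x \<in> carrier ?Z \<and> x k = 1 mod int p ^ k"
    define y where "y = x \<ominus>\<^bsub>?Z\<^esub> \<one>\<^bsub>?Z\<^esub>"
    have y: "y \<in> carrier ?Z" and xy: "x = \<one>\<^bsub>?Z\<^esub> \<oplus>\<^bsub>?Z\<^esub> y"
      using x by (auto simp: y_def a_minus_def add.m_ac r_neg)
    from xy x have "(1 + y k) mod int p ^ k = 1 mod int p ^ k"
      by (metis padic_ops(2,3) mod_add_left_eq)
    then have "int p ^ k dvd y k"
      by (simp add: mod_eq_dvd_iff)
    then have yk: "y k = 0" using padic_mod[OF y, of k] by simp
    have dvd: "int p ^ k dvd y (n + k)" for n
      using padic_mod_le[OF y, of k "n + k"] yk by (simp add: mod_0_imp_dvd)
    define z where "z = (\<lambda>n. y (n + k) div int p ^ k)"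
    have "z \<in> carrier ?Z"
      unfolding padic_carrier_iff
    proof (intro allI conjI)
      fix n
      have b: "0 \<le> y (n + k)" "y (n + k) < int p ^ n * int p ^ k"
        using y by (auto simp: padic_carrier_iff power_add[symmetric])
      show "0 \<le> z n" using b assms by (simp add: z_def pos_imp_zdiv_nonneg_iff)
      obtain c where c: "y (n + k) = int p ^ k * c" using dvd[of n] by (auto elim: dvdE)
      have pk: "int p ^ k > 0" using assms by simp
      show "z n < int p ^ n" using b(2) c pk by (simp add: z_def mult.commute)
      obtain d where d: "y (Suc n + k) = int p ^ k * d" using dvd[of "Suc n"] by (auto elim: dvdE)
      have "y (Suc n + k) mod int p ^ (n + k) = y (n + k)"
        using padic_mod_le[OF y, of "n + k" "Suc n + k"] by simp
      then have "(int p ^ k * d) mod (int p ^ k * int p ^ n) = int p ^ k * c"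
        by (simp only: c d power_add mult.commute)
      then have "int p ^ k * (d mod int p ^ n) = int p ^ k * c"
        by (simp only: mult_mod_right)
      then have "d mod int p ^ n = c" using assms by simp
      then show "z (Suc n) mod int p ^ n = z n"
        using c d pk by (simp add: z_def)
    qed
    moreover have "y = add_pow ?Z (p ^ k) z"
    proof
      fix n
      have "int p ^ k * z n = y (n + k)" using dvd[of n] by (simp add: z_def)
      then show "y n = add_pow ?Z (p ^ k) z n"
        using padic_mod_le[OF y, of n "n + k"] by (simp add: padic_add_pow[OF assms])
    qed
    ultimately show "x \<in> principal_units p k"
      using xy by (auto simp: principal_units_def)
  qed
qed

lemma principal_units_mono:
  assumes "p > 0" "k \<le> m"
  shows "principal_units p m \<subseteq> principal_units p k"
proof
  fix x assume x: "x \<in> principal_units p m"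
  then have "x k = 1 mod int p ^ m mod int p ^ k"
    using padic_mod_le[of x p k m] assms by (simp add: principal_units_iff)
  also have "\<dots> = 1 mod int p ^ k"
    using assms(2) by (simp add: mod_mod_cancel le_imp_power_dvd)
  finally show "x \<in> principal_units p k"
    using x assms by (simp add: principal_units_iff)
qed

lemma principal_unit_inverse:
  assumes "p > 0" "k > 0" "x \<in> principal_units p k"
  obtains y where "y \<in> principal_units p k" "x \<otimes>\<^bsub>padic_ints p\<^esub> y = \<one>\<^bsub>padic_ints p\<^esub>"
proof -
  have x: "x \<in> carrier (padic_ints p)" "x k = 1 mod int p ^ k"
    using assms by (auto simp: principal_units_iff)
  have x1: "x 1 = 1 mod int p"
    using padic_mod_le[OF x(1), of 1 k] assms x(2) by (simp add: mod_mod_cancel)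
  have cop: "coprime (x n) (int p ^ n)" for n
  proof (cases n)
    case (Suc m)
    then have "x n mod int p = 1 mod int p"
      using padic_mod_le[OF x(1), of 1 n] x1 by simp
    then have "coprime (x n) (int p)"
      by (metis coprime_1_left coprime_mod_left_iff assms(1) of_nat_0_less_iff less_irrefl)
    then show ?thesis by simp
  qed simp
  have "\<exists>y. (x n * y) mod int p ^ n = 1 mod int p ^ n" for n
    using cong_solve_coprime_int[OF cop[of n]] by (auto simp: cong_def)
  then obtain f where f: "\<And>n. (x n * f n) mod int p ^ n = 1 mod int p ^ n" by metis
  define y where "y = (\<lambda>n. f n mod int p ^ n)"
  have "f (Suc n) mod int p ^ n = f n mod int p ^ n" for n
  proof -
    have "(x (Suc n) * f (Suc n)) mod int p ^ n = 1 mod int p ^ n"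
      using f[of "Suc n"] by (metis le_imp_power_dvd lessI less_imp_le mod_mod_cancel)
    then have "(x n * f (Suc n)) mod int p ^ n = (x n * f n) mod int p ^ n"
      by (metis f mod_mult_left_eq padic_mod_le[OF x(1)] lessI less_imp_le)
    then show ?thesis
      using cong_mult_lcancel[OF cop[of n]] by (simp add: cong_def)
  qed
  then have y: "y \<in> carrier (padic_ints p)"
    unfolding y_def by (rule padic_closedI[OF assms(1)])
  have xy: "x \<otimes>\<^bsub>padic_ints p\<^esub> y = \<one>\<^bsub>padic_ints p\<^esub>"
    by (rule ext) (simp add: padic_ops y_def mod_simps f)
  have "(x k * y k) mod int p ^ k = 1 mod int p ^ k"
    by (simp add: y_def mod_simps f)
  then have "y k = 1 mod int p ^ k"
    using x(2) padic_mod[OF y, of k] by (simp add: mod_simps)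
  then have "y \<in> principal_units p k" using y assms by (simp add: principal_units_iff)
  then show ?thesis using that xy by blast
qed

lemma subgroup_principal_units:
  assumes "p > 0" "k > 0"
  shows "subgroup (principal_units p k) (units_of (padic_ints p))"
proof -
  let ?Z = "padic_ints p"
  interpret cring ?Z using assms(1) by (rule cring_padic_ints)
  interpret U: group "units_of ?Z" by (rule units_group)
  have sub: "principal_units p k \<subseteq> Units ?Z"
  proof
    fix x assume x: "x \<in> principal_units p k"
    then obtain y where y: "y \<in> principal_units p k" "x \<otimes>\<^bsub>?Z\<^esub> y = \<one>\<^bsub>?Z\<^esub>"
      using principal_unit_inverse[OF assms] by blast
    then show "x \<in> Units ?Z"
      using x assms m_comm[of x y] by (auto simp: Units_def principal_units_iff)
  qed
  show ?thesis
  proof (rule U.subgroupI)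
    show "principal_units p k \<subseteq> carrier (units_of ?Z)"
      using sub by (simp add: units_of_carrier)
    have "\<one>\<^bsub>?Z\<^esub> \<in> principal_units p k"
      using assms by (simp add: principal_units_iff padic_ops)
    then show "principal_units p k \<noteq> {}" by blast
  next
    fix x assume x: "x \<in> principal_units p k"
    then obtain y where y: "y \<in> principal_units p k" "x \<otimes>\<^bsub>?Z\<^esub> y = \<one>\<^bsub>?Z\<^esub>"
      using principal_unit_inverse[OF assms] by blast
    moreover have "x \<in> carrier ?Z" "y \<in> carrier ?Z"
      using x y assms by (auto simp: principal_units_iff)
    ultimately have "inv\<^bsub>units_of ?Z\<^esub> x = y"
      using x sub by (intro U.inv_equality)
        (auto simp: units_of_mult units_of_one units_of_carrier m_comm)
    then show "inv\<^bsub>units_of ?Z\<^esub> x \<in> principal_units p k" using y by simp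
  next
    fix x y assume "x \<in> principal_units p k" "y \<in> principal_units p k"
    then show "x \<otimes>\<^bsub>units_of ?Z\<^esub> y \<in> principal_units p k"
      using assms by (auto simp: principal_units_iff units_of_mult padic_ops mod_simps)
  qed
qed

lemma normal_principal_units:
  assumes "p > 0" "r > 0"
  shows "principal_units p (q + r) \<lhd> principal_unit_group p r"
proof -
  interpret cring "padic_ints p" using assms(1) by (rule cring_padic_ints)
  interpret U: comm_group "units_of (padic_ints p)" by (rule units_comm_group)
  have r: "subgroup (principal_units p r) (units_of (padic_ints p))"
    and qr: "subgroup (principal_units p (q + r)) (units_of (padic_ints p))"
    using assms by (auto intro: subgroup_principal_units)
  interpret G: group "principal_unit_group p r"
    unfolding principal_unit_group_def using r by (rule U.subgroup_imp_group)
  interpret G: comm_group "principal_unit_group p r"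
    using subgroup.subset[OF r]
    by (intro G.group_comm_groupI) (auto simp: principal_unit_group_def intro!: U.m_comm)
  have "subgroup (principal_units p (q + r)) (principal_unit_group p r)"
    unfolding principal_unit_group_def
    using U.subgroup_incl[OF qr r] principal_units_mono[OF assms(1), of r "q + r"] by simp
  then show ?thesis by (rule G.subgroup_imp_normal)
qed

lemma unit_class_eqI:
  assumes "p > 0" "r > 0" "u \<in> principal_units p r" "v \<in> principal_units p r"
    and "u (q + r) = v (q + r)"
  shows "unit_class p r q u = unit_class p r q v"
proof -
  let ?G = "principal_unit_group p r" and ?Z = "padic_ints p"
  interpret cring ?Z using assms(1) by (rule cring_padic_ints)
  interpret N: normal "principal_units p (q + r)" ?G
    using assms(1,2) by (rule normal_principal_units)
  obtain w where w: "w \<in> principal_units p r" "v \<otimes>\<^bsub>?Z\<^esub> w = \<one>\<^bsub>?Z\<^esub>"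
    using principal_unit_inverse[OF assms(1,2,4)] .
  have car: "u \<in> carrier ?Z" "v \<in> carrier ?Z" "w \<in> carrier ?Z"
    using assms w by (auto simp: principal_units_iff)
  have mult: "x \<otimes>\<^bsub>?G\<^esub> y = x \<otimes>\<^bsub>?Z\<^esub> y" for x y
    by (simp add: principal_unit_group_def units_of_mult)
  have "(u \<otimes>\<^bsub>?Z\<^esub> w) (q + r) = (v \<otimes>\<^bsub>?Z\<^esub> w) (q + r)"
    by (simp add: padic_ops assms(5))
  then have "u \<otimes>\<^bsub>?Z\<^esub> w \<in> principal_units p (q + r)"
    using w car assms(1) by (simp add: principal_units_iff padic_ops(3))
  moreover have "u = (u \<otimes>\<^bsub>?Z\<^esub> w) \<otimes>\<^bsub>?G\<^esub> v"
    using car w(2) by (simp add: mult m_assoc m_comm[of w v])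
  ultimately have "u \<in> principal_units p (q + r) #>\<^bsub>?G\<^esub> v"
    unfolding r_coset_def by blast
  moreover have "v \<in> carrier ?G" using assms by (simp add: principal_unit_group_def)
  ultimately show ?thesis
    unfolding unit_class_def using N.repr_independence[OF _ _ N.subgroup_axioms] by simp
qed

lemma character_matrix_lift:
  assumes "p > 0" "r > 0" "a < p ^ q" "b < p ^ q"
    and "x \<in> carrier (padic_ints p)" "x q = int a"
    and "y \<in> carrier (padic_ints p)" "y q = int b"
  shows "character_matrix p r q \<chi> $$ (a, b) =
    \<chi> (unit_class p r q (\<one>\<^bsub>padic_ints p\<^esub> \<oplus>\<^bsub>padic_ints p\<^esub>
      add_pow (padic_ints p) (p ^ r) (x \<otimes>\<^bsub>padic_ints p\<^esub> y)))"
proof -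
  let ?Z = "padic_ints p"
  interpret cring ?Z using assms(1) by (rule cring_padic_ints)
  let ?a = "add_pow ?Z a \<one>\<^bsub>?Z\<^esub>" and ?b = "add_pow ?Z b \<one>\<^bsub>?Z\<^esub>"
  let ?u = "\<lambda>x y. \<one>\<^bsub>?Z\<^esub> \<oplus>\<^bsub>?Z\<^esub> add_pow ?Z (p ^ r) (x \<otimes>\<^bsub>?Z\<^esub> y)"
  have car: "?a \<in> carrier ?Z" "?b \<in> carrier ?Z" by simp_all
  have ab: "?a q = int a" "?b q = int b"
    using assms(3,4) by (auto simp: padic_add_pow[OF assms(1)] padic_ops mod_simps
        simp flip: of_nat_power of_nat_mod)
  have mem: "?u s t \<in> principal_units p r" if "s \<in> carrier ?Z" "t \<in> carrier ?Z" for s t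
    using that unfolding principal_units_def by blast
  have val: "?u s t (q + r) = (1 + int p ^ r * ((s q * t q) mod int p ^ q)) mod int p ^ (q + r)"
    if "s \<in> carrier ?Z" "t \<in> carrier ?Z" for s t
  proof -
    have "(s q * t q) mod int p ^ q = (s (q + r) * t (q + r)) mod int p ^ q"
      by (metis that padic_mod_le le_add1 mod_mult_eq)
    then have "int p ^ r * ((s q * t q) mod int p ^ q) =
        (int p ^ r * (s (q + r) * t (q + r))) mod int p ^ (q + r)"
      by (simp only: mult_mod_right power_add mult.commute[of "int p ^ q"])
    then show ?thesis
      by (simp add: padic_ops padic_add_pow[OF assms(1)] mod_simps)
  qed
  have "unit_class p r q (?u ?a ?b) = unit_class p r q (?u x y)"
    by (rule unit_class_eqI[OF assms(1,2) mem mem])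
      (simp_all only: val car assms ab)
  then show ?thesis using assms(3,4) by (simp add: character_matrix_def Let_def)
qed

end

theory Submission
  imports Defs
begin

text \<open>
  Write \<open>F n = \<chi>(1 + p\<^sup>r n)\<close>, a function of \<open>n\<close> modulo \<open>N = p\<^sup>q\<close>. Since
  \<open>(1 + p\<^sup>r ab) / (1 + p\<^sup>r cb) = 1 + p\<^sup>r (a - c) y\<close> with \<open>y = b / (1 + p\<^sup>r cb)\<close>, and the
  Moebius map \<open>b \<mapsto> y\<close> permutes \<open>\<int>/N\<close>, the scalar product of the rows \<open>a\<close> and \<open>c\<close> is
  \<open>S = \<Sum>\<^sub>y F (m y)\<close> with \<open>m = a - c\<close>. As \<open>F m * F (m y) = F (m (1 + (1 + p\<^sup>r m) y))\<close> and
  \<open>y \<mapsto> 1 + (1 + p\<^sup>r m) y\<close> also permutes \<open>\<int>/N\<close>, we get \<open>F m * S = S\<close>. Faithfulness gives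
  \<open>F m \<noteq> 1\<close> unless \<open>N\<close> divides \<open>m\<close>, so \<open>S = 0\<close>.
\<close>

section \<open>Sums of a twisted character over residues modulo \<open>N\<close>\<close>

lemma bij_betw_mod:
  fixes N :: int
  assumes "N > 0"
    and "\<And>x y. [g x = g y] (mod N) \<Longrightarrow> [x = y] (mod N)"
  shows "bij_betw (\<lambda>x. g x mod N) {0..<N} {0..<N}"
proof -
  have "inj_on (\<lambda>x. g x mod N) {0..<N}"
  proof (rule inj_onI)
    fix x y assume xy: "x \<in> {0..<N}" "y \<in> {0..<N}" "g x mod N = g y mod N"
    have "x mod N = y mod N"
      using assms(2)[of x y] xy(3) unfolding cong_def by blast
    then show "x = y" using xy(1,2) by (simp add: mod_pos_pos_trivial)
  qed
  moreover have "(\<lambda>x. g x mod N) ` {0..<N} \<subseteq> {0..<N}" using assms(1) by auto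
  ultimately show ?thesis
    unfolding bij_betw_def using endo_inj_surj[OF finite_atLeastLessThan_int] by blast
qed

text \<open>Since \<open>(1 + t * x) * (1 + t * y) = 1 + t * (x + y + t * x * y)\<close>, such an
  \<open>F\<close> is a character of the integers \<open>1 + t * x\<close>, read as a function of
  \<open>x\<close>. With \<open>N\<close> and \<open>t\<close> set to powers of \<open>p\<close>,
  the orthogonality argument needs only integer congruences.\<close>

locale twisted_character =
  fixes N t :: int and F :: "int \<Rightarrow> complex"
  assumes N_pos: "N > 0"
    and unit: "coprime (1 + t * x) N"
    and periodic: "[x = y] (mod N) \<Longrightarrow> F x = F y"
    and mult: "F x * F y = F (x + y + t * x * y)"
    and faithful: "F x = 1 \<Longrightarrow> N dvd x"
    and norm_F: "norm (F x) = 1"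
begin

lemma sum_permute:
  assumes "\<And>x y. [g x = g y] (mod N) \<Longrightarrow> [x = y] (mod N)"
  shows "(\<Sum>b\<in>{0..<N}. F (m * g b)) = (\<Sum>b\<in>{0..<N}. F (m * b))"
proof -
  have "F (m * (g b mod N)) = F (m * g b)" for b
    by (rule periodic) (simp add: cong_def mod_simps)
  moreover have "bij_betw (\<lambda>b. g b mod N) {0..<N} {0..<N}"
    using N_pos assms by (rule bij_betw_mod)
  ultimately show ?thesis
    using sum.reindex_bij_betw[of "\<lambda>b. g b mod N" "{0..<N}" "{0..<N}" "\<lambda>b. F (m * b)"] by simp
qed

lemma sum_multiples_eq_0:
  assumes "\<not> N dvd m"
  shows "(\<Sum>b\<in>{0..<N}. F (m * b)) = 0"
proof -
  let ?S = "\<Sum>b\<in>{0..<N}. F (m * b)"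
  have "F m * ?S = (\<Sum>b\<in>{0..<N}. F (m * (1 + (1 + t * m) * b)))"
    by (simp add: sum_distrib_left mult algebra_simps)
  also have "\<dots> = ?S"
  proof (rule sum_permute)
    fix x y assume "[1 + (1 + t * m) * x = 1 + (1 + t * m) * y] (mod N)"
    then show "[x = y] (mod N)"
      using cong_add_lcancel cong_mult_lcancel[OF unit[of m]] by blast
  qed
  \<comment> \<open>Now \<open>F m * ?S = ?S\<close>, and \<open>F m = 1\<close> would force
    \<open>N dvd m\<close>.\<close>
  finally show ?thesis using faithful assms by auto
qed

text \<open>On the unit circle \<open>cnj\<close> inverts, so each summand is a quotient of two
  values of \<open>F\<close>, hence a single value at a multiple of \<open>a - c\<close>.\<close>

lemma sum_mult_cnj:
  "(\<Sum>b\<in>{0..<N}. F (a * b) * cnj (F (c * b))) = (if [a = c] (mod N) then of_int N else 0)"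
proof -
  have F_cnj: "F x * cnj (F x) = 1" for x
    by (simp add: complex_norm_square[symmetric] norm_F)
  \<comment> \<open>\<open>w b\<close> inverts \<open>1 + t * (c * b)\<close> modulo
    \<open>N\<close>, so \<open>b * w b\<close> is the Moebius image of \<open>b\<close>.\<close>
  have "\<exists>w. [(1 + t * (c * b)) * w = 1] (mod N)" for b
    using cong_solve_coprime_int[OF unit[of "c * b"]] by auto
  then obtain w where w: "\<And>b. [(1 + t * (c * b)) * w b = 1] (mod N)" by metis
  have quot: "F (a * b) * cnj (F (c * b)) = F ((a - c) * (b * w b))" for b
  proof -
    let ?v = "1 + t * (c * b)"
    \<comment> \<open>The left side is the argument that \<open>mult\<close> produces from
      \<open>c * b\<close> and \<open>(a - c) * (b * w b)\<close>; the right side is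
      \<open>a * b\<close>.\<close>
    have "[c * b + (a - c) * b * (?v * w b) = c * b + (a - c) * b * 1] (mod N)"
      by (intro cong_add cong_mult w) simp_all
    then have "F (c * b + (a - c) * b * (?v * w b)) = F (a * b)"
      by (intro periodic) (simp add: algebra_simps)
    then have "F (a * b) = F (c * b) * F ((a - c) * (b * w b))"
      by (simp add: mult algebra_simps)
    then have "F (a * b) * cnj (F (c * b)) = (F (c * b) * cnj (F (c * b))) * F ((a - c) * (b * w b))"
      by simp
    then show ?thesis by (simp add: F_cnj)
  qed
  \<comment> \<open>Clearing both denominators leaves \<open>?v y * x\<close> and
    \<open>?v x * y\<close>, whose terms \<open>t * c * x * y\<close> cancel.\<close>
  have inj: "[x = y] (mod N)" if "[x * w x = y * w y] (mod N)" for x y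
  proof -
    let ?v = "\<lambda>b. 1 + t * (c * b)"
    have "[?v x * ?v y * (x * w x) = ?v x * ?v y * (y * w y)] (mod N)"
      using that by (rule cong_scalar_left)
    moreover have "[?v y * x * (?v x * w x) = ?v y * x * 1] (mod N)"
      and "[?v x * y * (?v y * w y) = ?v x * y * 1] (mod N)"
      by (intro cong_scalar_left w)+
    ultimately have "[?v y * x = ?v x * y] (mod N)"
      by (simp add: cong_def mult_ac)
    then have "N dvd ?v y * x - ?v x * y" by (simp add: cong_iff_dvd_diff)
    also have "?v y * x - ?v x * y = x - y" by (simp add: algebra_simps)
    finally show ?thesis by (simp add: cong_iff_dvd_diff)
  qed
  have "(\<Sum>b\<in>{0..<N}. F (a * b) * cnj (F (c * b))) = (\<Sum>b\<in>{0..<N}. F ((a - c) * b))"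
    using sum_permute[of "\<lambda>b. b * w b" "a - c", OF inj] by (simp add: quot)
  also have "\<dots> = (if [a = c] (mod N) then of_int N else 0)"
  proof (cases "[a = c] (mod N)")
    case True
    then have dvd: "N dvd a - c" by (simp add: cong_iff_dvd_diff)
    have "F ((a - c) * b) = 1" for b
    proof -
      have "[(a - c) * b = 0] (mod N)" using dvd by (simp add: cong_0_iff)
      then have "F ((a - c) * b) = F 0" by (rule periodic)
      moreover have "F 0 * F 0 = F 0" "F 0 \<noteq> 0" using mult[of 0 0] norm_F[of 0] by auto
      ultimately show ?thesis by simp
    qed
    then show ?thesis using True N_pos by simp
  next
    case False
    then show ?thesis using sum_multiples_eq_0[of "a - c"] by (simp add: cong_iff_dvd_diff)
  qed
  finally show ?thesis .
qed

end

section \<open>Rational integers \<open>1 + p^r * n\<close> among the principal units\<close>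

definition integral_unit :: "nat \<Rightarrow> nat \<Rightarrow> int \<Rightarrow> nat \<Rightarrow> int" where
  "integral_unit p r n = (\<lambda>k. (1 + int p ^ r * n) mod int p ^ k)"

lemma integral_unit_principal:
  assumes "p > 0"
  shows "integral_unit p r n \<in> principal_units p r"
proof -
  have "integral_unit p r n \<in> carrier (padic_ints p)"
    unfolding integral_unit_def by (rule padic_closedI[OF assms]) simp
  then show ?thesis
    using assms by (simp add: principal_units_iff integral_unit_def)
qed

lemma integral_unit_mult:
  "integral_unit p r x \<otimes>\<^bsub>principal_unit_group p r\<^esub> integral_unit p r y =
    integral_unit p r (x + y + int p ^ r * x * y)"
proof
  fix k
  have "(1 + int p ^ r * x) * (1 + int p ^ r * y) = 1 + int p ^ r * (x + y + int p ^ r * x * y)"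
    by (simp add: algebra_simps)
  then show "(integral_unit p r x \<otimes>\<^bsub>principal_unit_group p r\<^esub> integral_unit p r y) k =
      integral_unit p r (x + y + int p ^ r * x * y) k"
    by (simp add: principal_unit_group_def units_of_mult padic_ops integral_unit_def mod_mult_eq)
qed

text \<open>The factor \<open>p^r\<close> lifts a congruence modulo \<open>p^q\<close> to one modulo
  \<open>p^(q + r)\<close>, and component \<open>q + r\<close> determines the class by
  \<open>unit_class_eqI\<close>.\<close>

lemma integral_unit_periodic:
  assumes "[x = y] (mod int p ^ q)"
  shows "integral_unit p r x (q + r) = integral_unit p r y (q + r)"
proof -
  have "[int p ^ r * x = int p ^ r * y] (mod int p ^ r * int p ^ q)"
    using assms by (simp add: cong_def flip: mult_mod_right)
  then have "[1 + int p ^ r * x = 1 + int p ^ r * y] (mod int p ^ (q + r))"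
    by (simp add: power_add mult.commute cong_add_lcancel)
  then show ?thesis by (simp add: integral_unit_def cong_def)
qed

lemma unit_class_in_carrier:
  assumes "p > 0"
  shows "unit_class p r q (integral_unit p r n) \<in> carrier (unit_quotient p r q)"
  using integral_unit_principal[OF assms, of r n]
  by (auto simp: unit_quotient_def unit_class_def FactGroup_def RCOSETS_def
      principal_unit_group_def)

lemma faithful_character_root:
  assumes "p > 0" "faithful_character p r q \<chi>"
  shows "\<chi> (unit_class p r q (integral_unit p r n)) ^ (p ^ q) = 1"
  using hom_in_carrier[of \<chi> "unit_quotient p r q" "roots_of_unity_group (p ^ q)",
      OF _ unit_class_in_carrier[OF assms(1)]] assms(2)
  by (simp add: faithful_character_def roots_of_unity_group_def)

text \<open>The homomorphism law yields \<open>mult\<close>, the values being roots of unity yields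
  \<open>norm_F\<close>, and injectivity yields \<open>faithful\<close>.\<close>

lemma twisted_character_faithful_character:
  assumes p: "p > 1" "r \<ge> 1" and \<chi>: "faithful_character p r q \<chi>"
  shows "twisted_character (int p ^ q) (int p ^ r)
    (\<lambda>n. \<chi> (unit_class p r q (integral_unit p r n)))"
proof -
  let ?G = "principal_unit_group p r" and ?u = "integral_unit p r"
  let ?U = "\<lambda>n. unit_class p r q (?u n)"
  have p0: "p > 0" and r0: "r > 0" using p by auto
  interpret N: normal "principal_units p (q + r)" ?G
    using p0 r0 by (rule normal_principal_units)
  have u: "?u n \<in> carrier ?G" for n
    using integral_unit_principal[OF p0] by (simp add: principal_unit_group_def)
  have hom: "\<chi> \<in> hom (unit_quotient p r q) (roots_of_unity_group (p ^ q))"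
    and inj: "inj_on \<chi> (carrier (unit_quotient p r q))"
    using \<chi> by (auto simp: faithful_character_def)
  have U: "?U n \<in> carrier (unit_quotient p r q)" for n
    by (rule unit_class_in_carrier[OF p0])
  have norm: "norm (\<chi> (?U n)) = 1" for n
  proof (rule power_eq_imp_eq_base)
    show "norm (\<chi> (?U n)) ^ (p ^ q) = 1 ^ (p ^ q)"
      using faithful_character_root[OF p0 \<chi>, of n] by (metis norm_one norm_power power_one)
  qed (use p0 in auto)
  have mult: "\<chi> (?U x) * \<chi> (?U y) = \<chi> (?U (x + y + int p ^ r * x * y))" for x y
  proof -
    have "?U x \<otimes>\<^bsub>unit_quotient p r q\<^esub> ?U y = ?U (x + y + int p ^ r * x * y)"
      by (simp add: unit_quotient_def unit_class_def FactGroup_def N.rcos_sum u integral_unit_mult)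
    then show ?thesis
      using hom_mult[OF hom U[of x] U[of y]] by (simp add: roots_of_unity_group_def)
  qed
  show ?thesis
  proof
    show "int p ^ q > 0" using p0 by simp
    fix x y
    \<comment> \<open>Here \<open>r \<ge> 1\<close> matters: a common divisor of \<open>p\<close>
      and \<open>1 + p^r * x\<close> divides 1.\<close>
    have "int p dvd int p ^ r * x" using r0 by (intro dvd_mult2 dvd_power) simp
    then have "coprime (1 + int p ^ r * x) (int p)"
      by (intro coprimeI) (use dvd_add_left_iff dvd_trans in blast)
    then show "coprime (1 + int p ^ r * x) (int p ^ q)" by simp
    show "norm (\<chi> (?U x)) = 1" by (rule norm)
    show "\<chi> (?U x) * \<chi> (?U y) = \<chi> (?U (x + y + int p ^ r * x * y))" by (rule mult)
    show "\<chi> (?U x) = \<chi> (?U y)" if "[x = y] (mod int p ^ q)"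
      using p0 r0 integral_unit_principal[OF p0] integral_unit_principal[OF p0]
        integral_unit_periodic[OF that] by (rule arg_cong[where f = \<chi>, OF unit_class_eqI])
    assume one: "\<chi> (?U x) = 1"
    \<comment> \<open>\<open>?U 0\<close> is the identity coset, so injectivity puts
      \<open>?u x\<close> into the subgroup; its component \<open>q + r\<close> then gives the
      divisibility.\<close>
    have "\<chi> (?U 0) = 1" using mult[of 0 0] norm[of 0] by auto
    then have "?U x = ?U 0" using inj_onD[OF inj _ U U] one by simp
    moreover have "?u x \<in> ?U x"
      unfolding unit_class_def using u N.subgroup_axioms by (rule N.rcos_self)
    moreover have "?u 0 \<in> principal_units p (q + r)"
      using integral_unit_principal[OF p0, of r 0] p0
      by (simp add: principal_units_iff integral_unit_def)
    then have "?U 0 = principal_units p (q + r)"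
      unfolding unit_class_def using N.rcos_const by simp
    ultimately have "?u x \<in> principal_units p (q + r)" by simp
    then have "(1 + int p ^ r * x) mod int p ^ (q + r) = 1 mod int p ^ (q + r)"
      using p0 by (simp add: principal_units_iff integral_unit_def)
    then have "int p ^ r * int p ^ q dvd int p ^ r * x"
      by (simp add: mod_eq_dvd_iff power_add mult.commute)
    then show "int p ^ q dvd x" using p0 by simp
  qed
qed

section \<open>Entries and row products of the matrix\<close>

lemma character_matrix_entry:
  assumes "p > 0" "a < p ^ q" "b < p ^ q"
  shows "character_matrix p r q \<chi> $$ (a, b) =
    \<chi> (unit_class p r q (integral_unit p r (int a * int b)))"
proof -
  let ?Z = "padic_ints p"
  have "\<one>\<^bsub>?Z\<^esub> \<oplus>\<^bsub>?Z\<^esub> add_pow ?Z (p ^ r) (add_pow ?Z a \<one>\<^bsub>?Z\<^esub> \<otimes>\<^bsub>?Z\<^esub> add_pow ?Z b \<one>\<^bsub>?Z\<^esub>) =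
      integral_unit p r (int a * int b)"
    by (rule ext) (simp add: padic_ops padic_add_pow[OF assms(1)] integral_unit_def mod_simps)
  then show ?thesis using assms(2,3) by (simp add: character_matrix_def Let_def)
qed

theorem theorem2p1:
  fixes p r q :: nat and \<chi> :: "(nat \<Rightarrow> int) set \<Rightarrow> complex"
  assumes "prime p" and "odd p" and "r \<ge> 1" and "q \<ge> 1"
    and "faithful_character p r q \<chi>"
  shows "butson (p ^ q) (p ^ q) (character_matrix p r q \<chi>)"
proof -
  define F where "F = (\<lambda>n. \<chi> (unit_class p r q (integral_unit p r n)))"
  let ?H = "character_matrix p r q \<chi>" and ?n = "p ^ q"
  have p: "p > 1" "p > 0" using prime_gt_1_nat[OF assms(1)] by auto
  interpret twisted_character "int p ^ q" "int p ^ r" F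
    unfolding F_def by (rule twisted_character_faithful_character[OF p(1) assms(3,5)])
  have car: "?H \<in> carrier_mat ?n ?n" by (simp add: character_matrix_def)
  have entry: "?H $$ (a, b) = F (int a * int b)" if "a < ?n" "b < ?n" for a b
    using character_matrix_entry[OF p(2) that] by (simp add: F_def)
  have root: "F n ^ ?n = 1" for n
    unfolding F_def by (rule faithful_character_root[OF p(2) assms(5)])
  have "?H * mat_adjoint ?H = of_nat ?n \<cdot>\<^sub>m 1\<^sub>m ?n"
  proof (rule eq_matI)
    fix a c assume "a < dim_row (of_nat ?n \<cdot>\<^sub>m 1\<^sub>m ?n :: complex mat)"
      "c < dim_col (of_nat ?n \<cdot>\<^sub>m 1\<^sub>m ?n :: complex mat)"
    then have ac: "a < ?n" "c < ?n" by simp_all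
    have "(?H * mat_adjoint ?H) $$ (a, c) = (\<Sum>b\<in>{0..<?n}. ?H $$ (a, b) * cnj (?H $$ (c, b)))"
      using ac car by (simp add: mat_adjoint_def scalar_prod_def mat_of_rows_index)
    also have "\<dots> = (\<Sum>b\<in>{0..<?n}. F (int a * int b) * cnj (F (int c * int b)))"
      using ac by (intro sum.cong) (auto simp: entry)
    \<comment> \<open>Column indices are naturals, while \<open>sum_mult_cnj\<close> sums over
      integers.\<close>
    also have "\<dots> = (\<Sum>b\<in>int ` {0..<?n}. F (int a * b) * cnj (F (int c * b)))"
      by (simp add: sum.reindex)
    also have "int ` {0..<?n} = {0..<int p ^ q}"
      by (simp add: image_int_atLeastLessThan)
    also have "(\<Sum>b\<in>\<dots>. F (int a * b) * cnj (F (int c * b))) =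
        (if [int a = int c] (mod int p ^ q) then of_int (int p ^ q) else 0)"
      by (rule sum_mult_cnj)
    \<comment> \<open>Both indices lie below the modulus, so congruent rows coincide.\<close>
    also have "[int a = int c] (mod int p ^ q) \<longleftrightarrow> a = c"
      using ac by (metis cong_int_iff cong_less_modulus_unique_nat cong_refl of_nat_power)
    finally show "(?H * mat_adjoint ?H) $$ (a, c) = (of_nat ?n \<cdot>\<^sub>m 1\<^sub>m ?n) $$ (a, c)"
      using ac by simp
  qed (use car in \<open>simp_all add: mat_adjoint_def\<close>)
  then show ?thesis
    using car by (auto simp: butson_def entry root)
qed

end
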